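(* Let $n\geq 3$ be an integer, and let $\mathbb{F}=\mathbb{R}$ or $\mathbb{F}=\mathbb{C}$. Let $f:\mathbb{F}\to\mathbb{F}$ be an entrywise positivity preserver on $M_n(\mathbb{F})$ such that the transform $A\mapsto f[A]$ is not a positive scalar multiple of either of the transforms $A\mapsto A$ and $A\mapsto\overline{A}=A^T$. Then there exists at least one matrix $A\in M_n(\mathbb{F})$ that is not positive semidefinite such that $f[A]$ is positive semidefinite.
   Context: $M_n(\mathbb{F})$ denotes the set of $n\times n$ matrices with entries in $\mathbb{F}$. For $f:\mathbb{F}\to\mathbb{F}$ and $A=(a_{ij})$, $f[A]:=(f(a_{ij}))$. Positive semidefinite matrices are Hermitian by definition (real symmetric when $\mathbb{F}=\mathbb{R}$). $f$ is an entrywise positivity preserver on $M_n(\mathbb{F})$ if $f[A]$ is positive semidefinite for every positive semidefinite $A\in M_n(\mathbb{F})$. The transform $A\mapsto f[A]$ being a positive scalar multiple of $A\mapsto A$ (respectively $A\mapsto\overline{A}$) means $f(z)=cz$ for all $z\in\mathbb{F}$ (respectively $f(z)=c\overline{z}$ for all $z\in\mathbb{F}$) for some real $c>0$. *)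

theory Defs
  imports "Jordan_Normal_Form.Schur_Decomposition"
begin

text \<open>
  The definitions are polymorphic so that one text serves both the real and the complex case:
  \<^term>\<open>conjugate\<close> is the identity on the reals and complex conjugation on the complex numbers.
  Over the complex numbers \<open>0 \<le> z\<close> says that \<open>z\<close> is real and nonnegative.
\<close>

definition psd_mat :: "nat \<Rightarrow> 'a :: conjugatable_ordered_field mat \<Rightarrow> bool" where
  "psd_mat n A \<longleftrightarrow> A \<in> carrier_mat n n \<and> mat_adjoint A = A
     \<and> (\<forall>v \<in> carrier_vec n. 0 \<le> (A *\<^sub>v v) \<bullet>c v)"

text \<open>The entrywise transform \<open>f[A]\<close> is \<^term>\<open>map_mat f A\<close>.\<close>

definition entrywise_positivity_preserver ::
    "nat \<Rightarrow> ('a :: conjugatable_ordered_field \<Rightarrow> 'a) \<Rightarrow> bool" where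
  "entrywise_positivity_preserver n f \<longleftrightarrow> (\<forall>A. psd_mat n A \<longrightarrow> psd_mat n (map_mat f A))"

definition pos_multiple_of_id ::
    "('a :: {conjugatable_ordered_field, real_algebra_1} \<Rightarrow> 'a) \<Rightarrow> bool" where
  "pos_multiple_of_id f \<longleftrightarrow> (\<exists>c::real. c > 0 \<and> (\<forall>z. f z = of_real c * z))"

definition pos_multiple_of_conjugate ::
    "('a :: {conjugatable_ordered_field, real_algebra_1} \<Rightarrow> 'a) \<Rightarrow> bool" where
  "pos_multiple_of_conjugate f \<longleftrightarrow> (\<exists>c::real. c > 0 \<and> (\<forall>z. f z = of_real c * conjugate z))"

end

theory Submission
  imports Defs
begin

text \<open>
  If no such matrix exists, then \<open>A\<close> is positive semidefinite if and only if \<open>f[A]\<close> is; repeating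
  the last row and column transfers this equivalence to matrices of size at most 3. For
  \<open>2 \<times> 2\<close> matrices it says that \<open>|z|\<^sup>2 \<le> m k\<close> if and only if \<open>|f z|\<^sup>2 \<le> f m * f k\<close>, so \<open>f\<close> is
  increasing and unbounded on \<open>[0, \<infinity>)\<close> and vanishes at 0. The matrices with rows \<open>(d, 0, b)\<close>,
  \<open>(0, d, e)\<close>, \<open>(b, e, d)\<close> are positive semidefinite if and only if \<open>b\<^sup>2 + e\<^sup>2 \<le> d\<^sup>2\<close>, and this forces
  \<open>f r = c r\<close> for \<open>r \<ge> 0\<close>. Finally, for \<open>|x| = |y|\<close>, the Schur complement of the corner entry 1 in
  the matrix with diagonal \<open>m, m, 1\<close> and upper entries \<open>z, x, y\<close> encodes the inequality
  \<open>|z - x cnj y| \<le> m - |x|\<^sup>2\<close>, so \<open>g = f / c\<close> preserves \<open>|z - x cnj y|\<close>. Hence \<open>g\<close> is an isometry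
  fixing 0 and 1, that is, the identity or the conjugation.
\<close>

section \<open>Reduction from size n to size 3\<close>

text \<open>Rows and columns are repeated, not padded with zeros: padding would bring the value
  \<open>f 0\<close> into the image, and that it vanishes is known only much later.\<close>

definition blow_up :: "nat \<Rightarrow> (nat \<Rightarrow> nat \<Rightarrow> 'a) \<Rightarrow> 'a mat" where
  "blow_up n a = mat n n (\<lambda>(i, j). a (min i 2) (min j 2))"

lemma blow_up_carrier [simp]: "blow_up n a \<in> carrier_mat n n"
  by (simp add: blow_up_def)

lemma map_mat_blow_up: "map_mat f (blow_up n a) = blow_up n (\<lambda>p q. f (a p q))"
  by (rule eq_matI) (auto simp: blow_up_def)

text \<open>The two-argument form of \<open>g\<close> makes the dependence on \<open>min i 2\<close>
  explicit, so that it is constant on each fibre and can be factored out.\<close>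

lemma sum_fibres_min_2:
  fixes g :: "nat \<Rightarrow> nat \<Rightarrow> 'a :: comm_monoid_add"
  assumes "n \<ge> 3"
  shows "(\<Sum>i<n. g (min i 2) i) = (\<Sum>p<3. \<Sum>i\<in>{i\<in>{..<n}. min i 2 = p}. g p i)"
proof -
  have "(\<Sum>p<3. \<Sum>i\<in>{i\<in>{..<n}. min i 2 = p}. g (min i 2) i) = (\<Sum>i<n. g (min i 2) i)"
    by (rule sum.group) auto
  moreover have "(\<Sum>p<3. \<Sum>i\<in>{i\<in>{..<n}. min i 2 = p}. g (min i 2) i)
      = (\<Sum>p<3. \<Sum>i\<in>{i\<in>{..<n}. min i 2 = p}. g p i)"
    by (intro sum.cong) auto
  ultimately show ?thesis by simp
qed

text \<open>The entries are constant on products of fibres of \<open>min i 2\<close>, so the form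
  sees \<open>v\<close> only through its sums over the fibres.\<close>

lemma blow_up_quadratic_form:
  fixes a :: "nat \<Rightarrow> nat \<Rightarrow> 'a :: conjugatable_ordered_field"
  assumes n: "n \<ge> 3" and v: "v \<in> carrier_vec n"
  defines "w \<equiv> \<lambda>p. \<Sum>i\<in>{i\<in>{..<n}. min i 2 = p}. v $ i"
  shows "(blow_up n a *\<^sub>v v) \<bullet>c v = (\<Sum>p<3. \<Sum>q<3. a p q * w q * conjugate (w p))"
proof -
  have inner: "(\<Sum>j<n. a p (min j 2) * v $ j) = (\<Sum>q<3. a p q * w q)" for p
    by (subst sum_fibres_min_2[OF n, of "\<lambda>q j. a p q * v $ j"]) (simp add: w_def sum_distrib_left)
  have "(blow_up n a *\<^sub>v v) \<bullet>c v
      = (\<Sum>i<n. (\<Sum>j<n. a (min i 2) (min j 2) * v $ j) * conjugate (v $ i))"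
    using v by (auto simp: blow_up_def scalar_prod_def lessThan_atLeast0 intro!: sum.cong)
  also have "\<dots> = (\<Sum>i<n. (\<Sum>q<3. a (min i 2) q * w q) * conjugate (v $ i))"
    by (simp add: inner)
  also have "\<dots> = (\<Sum>p<3. \<Sum>i\<in>{i\<in>{..<n}. min i 2 = p}. (\<Sum>q<3. a p q * w q) * conjugate (v $ i))"
    by (rule sum_fibres_min_2[OF n, of "\<lambda>p i. (\<Sum>q<3. a p q * w q) * conjugate (v $ i)"])
  also have "\<dots> = (\<Sum>p<3. \<Sum>q<3. a p q * w q * conjugate (w p))"
    by (simp add: w_def sum_distrib_left[symmetric] sum_distrib_right[symmetric] sum_conjugate)
  finally show ?thesis .
qed

lemma psd_blow_up_iff:
  fixes a :: "nat \<Rightarrow> nat \<Rightarrow> 'a :: conjugatable_ordered_field"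
  assumes n: "n \<ge> 3"
  shows "psd_mat n (blow_up n a) \<longleftrightarrow>
    (\<forall>p<3. \<forall>q<3. conjugate (a p q) = a q p) \<and>
    (\<forall>w. 0 \<le> (\<Sum>p<3. \<Sum>q<3. a p q * w q * conjugate (w p)))"
proof -
  have herm: "mat_adjoint (blow_up n a) = blow_up n a \<longleftrightarrow>
      (\<forall>p<3. \<forall>q<3. conjugate (a p q) = a q p)"
  proof
    assume eq: "mat_adjoint (blow_up n a) = blow_up n a"
    show "\<forall>p<3. \<forall>q<3. conjugate (a p q) = a q p"
    proof (intro allI impI)
      fix p q :: nat assume "p < 3" "q < 3"
      then have "mat_adjoint (blow_up n a) $$ (q, p) = conjugate (a p q)"
        using n by (auto simp: blow_up_def mat_adjoint_def mat_of_rows_def)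
      moreover have "blow_up n a $$ (q, p) = a q p"
        using \<open>p < 3\<close> \<open>q < 3\<close> n by (auto simp: blow_up_def)
      ultimately show "conjugate (a p q) = a q p" using eq by simp
    qed
  next
    assume "\<forall>p<3. \<forall>q<3. conjugate (a p q) = a q p"
    then show "mat_adjoint (blow_up n a) = blow_up n a"
      by (intro eq_matI) (auto simp: blow_up_def mat_adjoint_def mat_of_rows_def)
  qed
  have "(\<forall>v\<in>carrier_vec n. 0 \<le> (blow_up n a *\<^sub>v v) \<bullet>c v) \<longleftrightarrow>
      (\<forall>w. 0 \<le> (\<Sum>p<3. \<Sum>q<3. a p q * w q * conjugate (w p)))"
  proof safe
    fix w :: "nat \<Rightarrow> 'a"
    assume pos: "\<forall>v\<in>carrier_vec n. 0 \<le> (blow_up n a *\<^sub>v v) \<bullet>c v"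
    \<comment> \<open>Extending \<open>w\<close> by zero leaves one possibly nonzero entry in each
      fibre, so every \<open>w\<close> is a vector of fibre sums.\<close>
    define v where "v = vec n (\<lambda>i. if i < 3 then w i else 0)"
    have v: "v \<in> carrier_vec n" by (simp add: v_def)
    have w: "(\<Sum>i\<in>{i. i < n \<and> min i 2 = p}. v $ i) = w p" if "p < 3" for p
    proof -
      have "(\<Sum>i\<in>{i. i < n \<and> min i 2 = p}. v $ i) = (\<Sum>i\<in>{p}. v $ i)"
        using that n by (intro sum.mono_neutral_right) (auto simp: v_def)
      then show ?thesis using that n by (simp add: v_def)
    qed
    have "(blow_up n a *\<^sub>v v) \<bullet>c v = (\<Sum>p<3. \<Sum>q<3. a p q * w q * conjugate (w p))"
      unfolding blow_up_quadratic_form[OF n v]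
      by (intro sum.cong refl) (simp add: w)
    then show "0 \<le> (\<Sum>p<3. \<Sum>q<3. a p q * w q * conjugate (w p))"
      using pos v by metis
  qed (simp add: blow_up_quadratic_form[OF n])
  then show ?thesis by (simp add: psd_mat_def herm)
qed

text \<open>
  The real case is embedded in the complex numbers: \<open>K\<close> is the scalar field, either \<open>\<real>\<close> or \<open>UNIV\<close>,
  and the entries with an index above 2 are irrelevant.
\<close>

definition psd_form :: "complex set \<Rightarrow> (nat \<Rightarrow> nat \<Rightarrow> complex) \<Rightarrow> bool" where
  "psd_form K a \<longleftrightarrow> (\<forall>p<3. \<forall>q<3. cnj (a p q) = a q p) \<and>
     (\<forall>w. (\<forall>p. w p \<in> K) \<longrightarrow> 0 \<le> (\<Sum>p<3. \<Sum>q<3. a p q * w q * cnj (w p)))"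

lemma psd_blow_up_complex:
  "n \<ge> 3 \<Longrightarrow> psd_mat n (blow_up n a) \<longleftrightarrow> psd_form UNIV a"
  by (simp add: psd_blow_up_iff psd_form_def)

lemma psd_blow_up_real:
  assumes "n \<ge> 3"
  shows "psd_mat n (blow_up n a) \<longleftrightarrow> psd_form \<real> (\<lambda>p q. complex_of_real (a p q))"
proof -
  have "(\<forall>w::nat \<Rightarrow> real. P (\<lambda>p. complex_of_real (w p))) \<longleftrightarrow> (\<forall>w. (\<forall>p. w p \<in> \<real>) \<longrightarrow> P w)" for P
  proof safe
    fix w :: "nat \<Rightarrow> complex"
    assume *: "\<forall>w::nat \<Rightarrow> real. P (\<lambda>p. complex_of_real (w p))" and "\<forall>p. w p \<in> \<real>"
    then have "w = (\<lambda>p. complex_of_real (Re (w p)))" by simp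
    then show "P w" using * by metis
  qed auto
  note * = this[of "\<lambda>w. 0 \<le> (\<Sum>p<3. \<Sum>q<3. complex_of_real (a p q) * w q * cnj (w p))"]
  have "(\<Sum>p<3. \<Sum>q<3. complex_of_real (a p q) * complex_of_real (w q) * cnj (complex_of_real (w p)))
     = complex_of_real (\<Sum>p<3. \<Sum>q<3. a p q * w q * w p)" for w by simp
  then show ?thesis
    using assms unfolding psd_form_def *[symmetric]
    by (simp add: psd_blow_up_iff less_eq_complex_def del: of_real_sum)
qed

section \<open>Hermitian 3 x 3 matrices and binary forms\<close>

text \<open>The upper triangle is read row by row: \<open>A z x\<close>, then \<open>B y\<close>,
  then \<open>C\<close>. The matrix is Hermitian only if the diagonal entries are real.\<close>

definition herm3 :: "complex \<Rightarrow> complex \<Rightarrow> complex \<Rightarrow> complex \<Rightarrow> complex \<Rightarrow> complex \<Rightarrow> nat \<Rightarrow> nat \<Rightarrow> complex"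
  where "herm3 A z x B y C p q =
    (if p = 0 then (if q = 0 then A else if q = 1 then z else x)
     else if p = 1 then (if q = 0 then cnj z else if q = 1 then B else y)
     else (if q = 0 then cnj x else if q = 1 then cnj y else C))"

text \<open>This is the form of the 2 x 2 matrix with diagonal \<open>A\<close>, \<open>B\<close>
  and off-diagonal entry \<open>z\<close>. Test vectors give necessity; the inequality between
  arithmetic and geometric means gives sufficiency.\<close>

lemma psd_form_2:
  fixes A B :: real
  assumes K: "K = \<real> \<or> K = UNIV" and z: "z \<in> K"
  shows "(\<forall>u\<in>K. \<forall>v\<in>K. 0 \<le> A * (cmod u)\<^sup>2 + B * (cmod v)\<^sup>2 + 2 * Re (z * v * cnj u))
     \<longleftrightarrow> 0 \<le> A \<and> 0 \<le> B \<and> (cmod z)\<^sup>2 \<le> A * B" (is "?L \<longleftrightarrow> ?R")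
proof
  assume L: ?L
  have el: "-z \<in> K" "0 \<in> K" "1 \<in> K" "of_real r \<in> K" "-cnj z \<in> K" for r
    using K z by (auto simp: Reals_cnj_iff)
  have A: "0 \<le> A" using L[rule_format, of 1 0] el by simp
  have B: "0 \<le> B" using L[rule_format, of 0 1] el by simp
  have zz: "(cmod z)\<^sup>2 = Re z * Re z + Im z * Im z"
    unfolding cmod_power2 by (simp add: power2_eq_square)
  \<comment> \<open>The vectors \<open>(-z, A)\<close> and \<open>(B, -cnj z)\<close> turn the form
    into \<open>A\<close> and \<open>B\<close> times the determinant.\<close>
  have 1: "0 \<le> A * (A * B - (cmod z)\<^sup>2)"
    using L[rule_format, of "-z" "of_real A"] el unfolding norm_minus_cancel zz
    by (simp add: algebra_simps power2_eq_square)
  have 2: "0 \<le> B * (A * B - (cmod z)\<^sup>2)"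
    using L[rule_format, of "of_real B" "-cnj z"] el unfolding norm_minus_cancel complex_mod_cnj zz
    by (simp add: algebra_simps power2_eq_square)
  \<comment> \<open>With zero diagonal the previous two inequalities are void; here the right side
    is -2 |z|^2, which forces \<open>z = 0\<close>.\<close>
  have 3: "0 \<le> A + B - 2 + (1 - (cmod z)\<^sup>2) * 2" if "A = 0" "B = 0"
    using L[rule_format, of "-z" 1] el that unfolding norm_minus_cancel zz
    by (simp add: algebra_simps power2_eq_square)
  have "(cmod z)\<^sup>2 \<le> A * B"
  proof (cases "A = 0 \<and> B = 0")
    case True
    then show ?thesis using 3 by simp
  next
    case False
    then show ?thesis using 1 2 A B by (auto simp: zero_le_mult_iff)
  qed
  then show ?R using A B by simp
next
  assume R: ?R
  show ?L
  proof (intro ballI)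
    fix u v
    have "cmod z \<le> sqrt A * sqrt B"
      using R by (metis abs_norm_cancel real_sqrt_abs real_sqrt_le_mono real_sqrt_mult)
    then have "cmod z * (cmod u * cmod v) \<le> sqrt A * sqrt B * (cmod u * cmod v)"
      by (intro mult_right_mono) auto
    moreover have "- (cmod z * (cmod u * cmod v)) \<le> Re (z * v * cnj u)"
      using complex_Re_le_cmod[of "- (z * v * cnj u)"] by (simp add: norm_mult mult.commute mult.left_commute)
    moreover have "0 \<le> (sqrt A * cmod u - sqrt B * cmod v)\<^sup>2" by simp
    then have "2 * (sqrt A * sqrt B * (cmod u * cmod v)) \<le> A * (cmod u)\<^sup>2 + B * (cmod v)\<^sup>2"
      using R by (simp add: power2_diff power_mult_distrib algebra_simps)
    ultimately show "0 \<le> A * (cmod u)\<^sup>2 + B * (cmod v)\<^sup>2 + 2 * Re (z * v * cnj u)"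
      by linarith
  qed
qed

section \<open>A functional inequality that forces linearity\<close>

text \<open>The equivalence gives monotonicity (\<open>y = 0\<close>), superadditivity
  (\<open>d = x + y\<close>) and, by negation, \<open>q d < q x + q y\<close> whenever
  \<open>d < x + y\<close>. Comparison at integer multiples then shows that \<open>q s / s\<close>
  is constant for \<open>s > 0\<close>; continuity is not assumed.\<close>

lemma superadditive_monotone_linear:
  fixes q :: "real \<Rightarrow> real"
  assumes q: "\<And>x y d. \<lbrakk>0 \<le> x; 0 \<le> y; 0 \<le> d\<rbrakk> \<Longrightarrow> q x + q y \<le> q d \<longleftrightarrow> x + y \<le> d"
    and q0: "q 0 = 0" and x: "0 \<le> x"
  shows "q x = q 1 * x"
proof -
  have mono: "q s \<le> q t \<longleftrightarrow> s \<le> t" if "0 \<le> s" "0 \<le> t" for s t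
    using q[of s 0 t] that q0 by simp
  have nonneg: "0 \<le> q s" if "0 \<le> s" for s
    using mono[of 0 s] that q0 by simp
  have lower: "of_nat k * q s \<le> q (of_nat k * s)" if "0 \<le> s" for k s
  proof (induction k)
    case (Suc k)
    have "q (of_nat k * s) + q s \<le> q (of_nat k * s + s)" using q that by simp
    with Suc show ?case by (simp add: algebra_simps)
  qed (simp add: q0)
  have upper: "q d \<le> of_nat k * q s" if "0 \<le> s" "0 \<le> d" "d < of_nat k * s" for d s k
    using that(2,3)
  proof (induction k arbitrary: d)
    case (Suc k)
    show ?case
    proof (cases "d \<le> s")
      case True
      then have "q d \<le> q s" using mono Suc.prems that by simp
      then show ?thesis using nonneg[OF that(1)] by (simp add: algebra_simps add_increasing2)
    next
      case False
      \<comment> \<open>The midpoint of \<open>d - s\<close> and \<open>k s\<close> keeps both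
        inequalities strict: the induction hypothesis needs \<open>e < k s\<close>, the negated
        equivalence needs \<open>d < s + e\<close>.\<close>
      define e where "e = ((d - s) + of_nat k * s) / 2"
      have e: "0 \<le> e" "e < of_nat k * s" "d < s + e"
        using False Suc.prems that by (auto simp: e_def field_simps)
      then have "q d < q s + q e" using q[of s e d] that Suc.prems by linarith
      with Suc.IH[OF e(1,2)] show ?thesis by (simp add: algebra_simps)
    qed
  qed simp
  have cross: "q s * t \<le> q t * s" if st: "0 < s" "0 < t" for s t
  proof (rule ccontr)
    assume "\<not> ?thesis"
    moreover have "0 < q t" using mono[of t 0] st q0 by simp
    ultimately have "s / t < q s / q t" using st by (simp add: field_simps)
    \<comment> \<open>A rational \<open>k / m\<close> strictly between the two ratios gives
      \<open>m s < k t\<close>, hence \<open>m q s \<le> q (m s) \<le> k q t\<close>, against the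
      choice of \<open>k / m\<close>.\<close>
    then obtain r where r: "r \<in> \<rat>" "s / t < r" "r < q s / q t" using Rats_dense_in_real by blast
    moreover have "0 < r" using r(2) st by (meson divide_pos_pos less_trans)
    ultimately obtain k m :: nat where km: "m \<noteq> 0" "r = of_nat k / of_nat m"
      using Rats_abs_nat_div_natE[of r] by (metis abs_of_pos)
    have "of_nat m * s < of_nat k * t" using r(2) km st by (simp add: field_simps)
    then have "q (of_nat m * s) \<le> of_nat k * q t" using upper[of t] st by simp
    then have "of_nat m * q s \<le> of_nat k * q t" using lower[of s m] st by linarith
    moreover have "of_nat k * q t < of_nat m * q s" using r(3) km \<open>0 < q t\<close> by (simp add: field_simps)
    ultimately show False by simp
  qed
  show ?thesis
    using cross[of x 1] cross[of 1 x] x q0 by (cases "x = 0") auto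
qed

section \<open>Positivity of 3 x 3 forms by Schur complements\<close>

text \<open>Completing the square in \<open>w 2\<close> leaves the form of the Schur complement of
  \<open>C\<close> in the variables \<open>w 0\<close> and \<open>w 1\<close>.\<close>

lemma herm3_form:
  fixes A B C :: real
  assumes C: "C \<noteq> 0"
  shows "(\<Sum>p<3. \<Sum>q<3. herm3 A z x B y C p q * w q * cnj (w p)) =
   of_real (C * (cmod (w 2 + (cnj x * w 0 + cnj y * w 1) / C))\<^sup>2 + (A - (cmod x)\<^sup>2 / C) * (cmod (w 0))\<^sup>2
     + (B - (cmod y)\<^sup>2 / C) * (cmod (w 1))\<^sup>2 + 2 * Re ((z - x * cnj y / C) * w 1 * cnj (w 0)))"
    (is "_ = of_real (C * _ + ?S + ?T + ?U)")
proof -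
  define s where "s = w 2 + (cnj x * w 0 + cnj y * w 1) / C"
  have w2: "w 2 = s - (cnj x * w 0 + cnj y * w 1) / C" by (simp add: s_def)
  have sq: "of_real ((cmod u)\<^sup>2) = u * cnj u" for u by (rule complex_norm_square)
  have re: "of_real (2 * Re u) = u + cnj u" for u by (simp add: complex_add_cnj)
  have "(\<Sum>p<3. \<Sum>q<3. herm3 A z x B y C p q * w q * cnj (w p)) =
    A * w 0 * cnj (w 0) + z * w 1 * cnj (w 0) + x * w 2 * cnj (w 0)
    + (cnj z * w 0 * cnj (w 1) + B * w 1 * cnj (w 1) + y * w 2 * cnj (w 1))
    + (cnj x * w 0 * cnj (w 2) + cnj y * w 1 * cnj (w 2) + C * w 2 * cnj (w 2))"
    by (simp add: herm3_def eval_nat_numeral)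
  also have "\<dots> = of_real (C * (cmod s)\<^sup>2 + ?S + ?T + ?U)"
    unfolding of_real_add of_real_mult[of C] of_real_mult[of "_ - _"] of_real_diff of_real_divide sq re w2
    using C by (simp add: field_simps)
  finally show ?thesis by (simp add: s_def)
qed

text \<open>The form is \<open>c\<close> times |w 0 + w 1 + w 2|^2. Constant matrices thus test the
  sign of \<open>f\<close> at a single point.\<close>

lemma psd_form_const:
  assumes "K = \<real> \<or> K = UNIV"
  shows "psd_form K (\<lambda>p q. c) \<longleftrightarrow> 0 \<le> c"
proof -
  have form: "(\<Sum>p<3. \<Sum>q<3. c * w q * cnj (w p)) = c * of_real ((cmod (w 0 + w 1 + w 2))\<^sup>2)"
    for w :: "nat \<Rightarrow> complex"
    unfolding complex_norm_square by (simp add: eval_nat_numeral algebra_simps)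
  show ?thesis
  proof
    assume *: "psd_form K (\<lambda>p q. c)"
    have "0 \<le> (\<Sum>p<3. \<Sum>q<3. c * (if q = (0::nat) then 1 else 0) * cnj (if p = (0::nat) then 1 else 0))"
      using * assms unfolding psd_form_def
      by (elim conjE allE[of _ "\<lambda>q. if q = 0 then 1 else 0"]) auto
    then show "0 \<le> c" unfolding form by simp
  next
    assume "0 \<le> c"
    then have "cnj c = c" "0 \<le> Re c" "Im c = 0" by (auto simp: less_eq_complex_def complex_eq_iff)
    then show "psd_form K (\<lambda>p q. c)"
      unfolding psd_form_def form by (auto simp: less_eq_complex_def simp del: of_real_power)
  qed
qed

text \<open>With equal first two rows the form depends only on \<open>w 0 + w 1\<close> and
  \<open>w 2\<close>, which leaves a 2 x 2 matrix. Unlike the Schur complement, this criterion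
  allows \<open>C = 0\<close>.\<close>

lemma psd_form_herm3_same_rows:
  fixes A C :: real
  assumes K: "K = \<real> \<or> K = UNIV" and z: "z \<in> K"
  shows "psd_form K (herm3 A A z A z C) \<longleftrightarrow> 0 \<le> A \<and> 0 \<le> C \<and> (cmod z)\<^sup>2 \<le> A * C"
proof -
  have form: "(\<Sum>p<3. \<Sum>q<3. herm3 A A z A z C p q * w q * cnj (w p)) =
     of_real (A * (cmod (w 0 + w 1))\<^sup>2 + C * (cmod (w 2))\<^sup>2 + 2 * Re (z * w 2 * cnj (w 0 + w 1)))" for w
  proof -
    have sq: "of_real ((cmod u)\<^sup>2) = u * cnj u" for u by (rule complex_norm_square)
    have re: "of_real (2 * Re u) = u + cnj u" for u by (simp add: complex_add_cnj)
    show ?thesis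
      unfolding of_real_add of_real_mult[of A] of_real_mult[of C] sq re
      by (simp add: herm3_def eval_nat_numeral algebra_simps)
  qed
  have "psd_form K (herm3 A A z A z C) \<longleftrightarrow>
     (\<forall>u\<in>K. \<forall>v\<in>K. 0 \<le> A * (cmod u)\<^sup>2 + C * (cmod v)\<^sup>2 + 2 * Re (z * v * cnj u))" (is "?L \<longleftrightarrow> ?R")
  proof
    assume L: ?L
    show ?R
    proof (intro ballI)
      fix u v assume "u \<in> K" "v \<in> K"
      then have "\<forall>p. (\<lambda>p::nat. if p = 0 then u else if p = 2 then v else 0) p \<in> K" using K by auto
      then show "0 \<le> A * (cmod u)\<^sup>2 + C * (cmod v)\<^sup>2 + 2 * Re (z * v * cnj u)"
        using L unfolding psd_form_def form
        by (elim conjE allE[of _ "\<lambda>p::nat. if p = 0 then u else if p = 2 then v else 0"])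
          (simp add: less_eq_complex_def)
    qed
  next
    assume R: ?R
    have "0 \<le> A * (cmod (w 0 + w 1))\<^sup>2 + C * (cmod (w 2))\<^sup>2 + 2 * Re (z * w 2 * cnj (w 0 + w 1))"
      if "\<forall>p. w p \<in> K" for w :: "nat \<Rightarrow> complex"
      by (rule R[rule_format]) (use that K in auto)
    then show ?L unfolding psd_form_def form less_eq_complex_def Re_complex_of_real Im_complex_of_real
      by (simp only: zero_complex.sel simp_thms) (simp add: herm3_def)
  qed
  then show ?thesis using psd_form_2[OF K z] by simp
qed

lemma psd_form_herm3:
  fixes A B C :: real
  assumes K: "K = \<real> \<or> K = UNIV" and xyz: "x \<in> K" "y \<in> K" "z \<in> K" and C: "0 < C"
  shows "psd_form K (herm3 A z x B y C) \<longleftrightarrow>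
    0 \<le> A - (cmod x)\<^sup>2 / C \<and> 0 \<le> B - (cmod y)\<^sup>2 / C \<and>
    (cmod (z - x * cnj y / C))\<^sup>2 \<le> (A - (cmod x)\<^sup>2 / C) * (B - (cmod y)\<^sup>2 / C)"
proof -
  have "psd_form K (herm3 A z x B y C) \<longleftrightarrow>
     (\<forall>u\<in>K. \<forall>v\<in>K. 0 \<le> (A - (cmod x)\<^sup>2 / C) * (cmod u)\<^sup>2 + (B - (cmod y)\<^sup>2 / C) * (cmod v)\<^sup>2
        + 2 * Re ((z - x * cnj y / C) * v * cnj u))" (is "?L \<longleftrightarrow> ?R")
  proof
    assume L: ?L
    show ?R
    proof (intro ballI)
      fix u v assume "u \<in> K" "v \<in> K"
      \<comment> \<open>The third coordinate is chosen to make the completed square vanish.\<close>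
      let ?w = "\<lambda>p::nat. if p = 0 then u else if p = 1 then v else - ((cnj x * u + cnj y * v) / C)"
      have "\<forall>p. ?w p \<in> K" using K xyz \<open>u \<in> K\<close> \<open>v \<in> K\<close> by (auto simp: Reals_cnj_iff)
      then have "0 \<le> (\<Sum>p<3. \<Sum>q<3. herm3 A z x B y C p q * ?w q * cnj (?w p))"
        using L[unfolded psd_form_def, THEN conjunct2, rule_format, of ?w] by blast
      then show "0 \<le> (A - (cmod x)\<^sup>2 / C) * (cmod u)\<^sup>2 + (B - (cmod y)\<^sup>2 / C) * (cmod v)\<^sup>2
        + 2 * Re ((z - x * cnj y / C) * v * cnj u)"
        using C by (subst (asm) herm3_form) (simp_all add: less_eq_complex_def del: minus_add_distrib)
    qed
  next
    assume R: ?R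
    have "0 \<le> (\<Sum>p<3. \<Sum>q<3. herm3 A z x B y C p q * w q * cnj (w p))" if "\<forall>p. w p \<in> K" for w
    proof -
      have "0 \<le> (A - (cmod x)\<^sup>2 / C) * (cmod (w 0))\<^sup>2 + (B - (cmod y)\<^sup>2 / C) * (cmod (w 1))\<^sup>2
        + 2 * Re ((z - x * cnj y / C) * w 1 * cnj (w 0))"
        using R that by blast
      moreover have "0 \<le> C * (cmod (w 2 + (cnj x * w 0 + cnj y * w 1) / C))\<^sup>2" using C by simp
      ultimately show ?thesis
        unfolding herm3_form[OF less_imp_neq[OF C, symmetric]] less_eq_complex_def
          Re_complex_of_real Im_complex_of_real by (simp only: zero_complex.sel) linarith
    qed
    then show ?L unfolding psd_form_def by (simp add: herm3_def)
  qed
  moreover have "z - x * cnj y / C \<in> K" using K xyz by (auto simp: Reals_cnj_iff)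
  ultimately show ?thesis by (simp only: psd_form_2[OF K])
qed

lemma map_herm3:
  assumes "f (cnj z) = cnj (f z)" "f (cnj x) = cnj (f x)" "f (cnj y) = cnj (f y)"
  shows "(\<lambda>p q. f (herm3 A z x B y C p q)) = herm3 (f A) (f z) (f x) (f B) (f y) (f C)"
  using assms by (auto simp: herm3_def fun_eq_iff)

section \<open>Maps that preserve and reflect positivity: moduli and values on the nonnegative
  reals\<close>

text \<open>This is the situation of a preserver for which the claimed matrix does not exist, stated
  for 3 x 3 forms and for both scalar fields at once.\<close>

locale two_sided_preserver =
  fixes K :: "complex set" and f :: "complex \<Rightarrow> complex"
  assumes K: "K = \<real> \<or> K = UNIV"
    and f_in: "z \<in> K \<Longrightarrow> f z \<in> K"
    and two_sided: "(\<And>p q. a p q \<in> K) \<Longrightarrow> psd_form K (\<lambda>p q. f (a p q)) \<longleftrightarrow> psd_form K a"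
begin

lemma of_real_in [simp]: "of_real r \<in> K" and cnj_in: "z \<in> K \<Longrightarrow> cnj z \<in> K"
  using K by (auto simp: Reals_cnj_iff)

lemma herm3_in: "\<lbrakk>A \<in> K; B \<in> K; C \<in> K; x \<in> K; y \<in> K; z \<in> K\<rbrakk> \<Longrightarrow> herm3 A z x B y C p q \<in> K"
  by (simp add: herm3_def cnj_in)

definition F :: "real \<Rightarrow> real" where "F r = Re (f (of_real r))"

lemma f_nonneg_iff: "z \<in> K \<Longrightarrow> 0 \<le> f z \<longleftrightarrow> 0 \<le> z"
  using two_sided[of "\<lambda>p q. z"] by (simp add: psd_form_const[OF K])

lemma f_of_real: "0 \<le> r \<Longrightarrow> f (of_real r) = of_real (F r)"
  and F_nonneg: "0 \<le> r \<Longrightarrow> 0 \<le> F r"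
  using f_nonneg_iff[of "of_real r"]
  by (auto simp: F_def less_eq_complex_def complex_eq_iff)

lemma f_cnj: assumes "z \<in> K" shows "f (cnj z) = cnj (f z)"
proof -
  \<comment> \<open>With |z| on the diagonal the matrix is positive semidefinite, so its image is
    Hermitian; \<open>z\<close> and \<open>cnj z\<close> stand in mirrored positions.\<close>
  let ?m = "complex_of_real (cmod z)"
  have "psd_form K (herm3 ?m ?m z ?m z ?m)"
    using psd_form_herm3_same_rows[OF K assms] by (simp add: power2_eq_square)
  then have "psd_form K (\<lambda>p q. f (herm3 ?m ?m z ?m z ?m p q))"
    using two_sided[of "herm3 ?m ?m z ?m z ?m"] herm3_in assms by simp
  then have "cnj (f (herm3 ?m ?m z ?m z ?m 0 2)) = f (herm3 ?m ?m z ?m z ?m 2 0)"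
    unfolding psd_form_def by simp
  then show ?thesis by (simp add: herm3_def)
qed

lemma two_sided_herm3:
  assumes "0 \<le> A" "0 \<le> B" "0 \<le> C" and xyz: "x \<in> K" "y \<in> K" "z \<in> K"
  shows "psd_form K (herm3 (F A) (f z) (f x) (F B) (f y) (F C)) \<longleftrightarrow>
    psd_form K (herm3 (of_real A) z x (of_real B) y (of_real C))"
  using two_sided[of "herm3 A z x B y C", OF herm3_in] assms
  by (simp add: map_herm3 f_cnj f_of_real)

lemma cmod_f_mult:
  assumes "0 \<le> m" "0 \<le> k" "z \<in> K"
  shows "(cmod (f z))\<^sup>2 \<le> F m * F k \<longleftrightarrow> (cmod z)\<^sup>2 \<le> m * k"
  using two_sided_herm3[of m m k z z "of_real m"] assms
  by (simp add: psd_form_herm3_same_rows[OF K] f_in f_of_real F_nonneg)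

lemma F_mult:
  assumes "0 \<le> m" "0 \<le> k" "0 \<le> r"
  shows "(F r)\<^sup>2 \<le> F m * F k \<longleftrightarrow> r\<^sup>2 \<le> m * k"
  using cmod_f_mult[of m k "of_real r"] assms by (simp add: f_of_real F_nonneg)

lemma cmod_f_le_iff:
  assumes "0 \<le> m" "z \<in> K"
  shows "cmod (f z) \<le> F m \<longleftrightarrow> cmod z \<le> m"
  using cmod_f_mult[of m m z] assms F_nonneg[of m]
  by (simp add: power2_eq_square[symmetric] abs_le_square_iff[symmetric])

lemma F_less_iff: "\<lbrakk>0 \<le> r; 0 \<le> m\<rbrakk> \<Longrightarrow> F r < F m \<longleftrightarrow> r < m"
  using cmod_f_le_iff[of r "of_real m"] F_nonneg[of m] by (auto simp: f_of_real)

lemma F_pos: "0 < r \<Longrightarrow> 0 < F r"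
  using F_less_iff[of 0 r] F_nonneg[of 0] by simp

text \<open>\<open>F\<close> grows at least geometrically along powers of 2, while \<open>(F 1)\<^sup>2 > F m * F 0\<close> for all \<open>m\<close>.\<close>

lemma F_0: "F 0 = 0"
proof (rule ccontr)
  assume "F 0 \<noteq> 0"
  then have F0: "0 < F 0" using F_nonneg[of 0] by simp
  define s where "s = F 2 / F 1"
  have s: "1 < s" using F_less_iff[of 1 2] F_pos[of 1] by (simp add: s_def)
  have ratio: "s * F (2 ^ k) \<le> F (2 ^ Suc k)" for k
  proof (induction k)
    case (Suc k)
    \<comment> \<open>\<open>2 ^ Suc k\<close> is the geometric mean of its neighbours, so the
      ratios of consecutive values of \<open>F\<close> along powers of 2 never decrease.\<close>
    have "(F (2 ^ Suc k))\<^sup>2 \<le> F (2 ^ k) * F (2 ^ Suc (Suc k))"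
      by (subst F_mult) (auto simp: power2_eq_square)
    moreover have "s * F (2 ^ k) * F (2 ^ Suc k) \<le> F (2 ^ Suc k) * F (2 ^ Suc k)"
      using Suc F_nonneg by (intro mult_right_mono) auto
    ultimately have "F (2 ^ k) * (s * F (2 ^ Suc k)) \<le> F (2 ^ k) * F (2 ^ Suc (Suc k))"
      by (simp add: power2_eq_square mult.commute mult.left_commute)
    then show ?case using F_pos[of "2 ^ k"] by (simp only: mult_le_cancel_left_pos zero_less_power zero_less_numeral)
  qed (use F_pos[of 1] in \<open>simp add: s_def\<close>)
  have growth: "s ^ k * F 1 \<le> F (2 ^ k)" for k
  proof (induction k)
    case (Suc k)
    have "s * (s ^ k * F 1) \<le> s * F (2 ^ k)" using Suc s by (intro mult_left_mono) auto
    with ratio[of k] show ?case by (simp add: mult.assoc)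
  qed simp
  obtain k where "(F 1)\<^sup>2 / (F 1 * F 0) < s ^ k" using real_arch_pow[OF s] by blast
  then have "(F 1)\<^sup>2 < s ^ k * F 1 * F 0" using F0 F_pos[of 1] by (simp add: field_simps)
  also have "\<dots> \<le> F (2 ^ k) * F 0" using growth[of k] F0 by (intro mult_right_mono) auto
  finally show False using F_mult[of "2 ^ k" 0 1] by simp
qed

text \<open>As \<open>f 0 = 0\<close>, arrow matrices go to arrow matrices, and the same criterion
  applies on both sides. The case \<open>d = 0\<close> is separate because the Schur complement
  needs a positive corner.\<close>

lemma F_sum_squares:
  assumes "0 \<le> b" "0 \<le> e" "0 \<le> d"
  shows "(F b)\<^sup>2 + (F e)\<^sup>2 \<le> (F d)\<^sup>2 \<longleftrightarrow> b\<^sup>2 + e\<^sup>2 \<le> d\<^sup>2"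
proof (cases "d = 0")
  case True
  then show ?thesis using assms F_0 F_pos[of b] F_pos[of e]
    by (cases "b = 0"; cases "e = 0") (auto simp: add_nonneg_eq_0_iff sum_power2_le_zero_iff)
next
  case False
  have arrow: "psd_form K (herm3 (of_real D) 0 (of_real B) (of_real D) (of_real E) (of_real D)) \<longleftrightarrow> B\<^sup>2 + E\<^sup>2 \<le> D\<^sup>2"
    if "0 < D" for B E D :: real
  proof -
    have diag: "D - X\<^sup>2 / D = (D\<^sup>2 - X\<^sup>2) / D" for X
      using that by (simp add: field_simps power2_eq_square)
    have sgn: "0 \<le> X / D \<longleftrightarrow> 0 \<le> X" for X using that by (simp add: zero_le_divide_iff)
    have off: "(cmod (0 - of_real B * cnj (of_real E) / of_real D))\<^sup>2 = (B * E)\<^sup>2 / D\<^sup>2"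
      using that by (simp add: norm_mult norm_divide power_divide power_mult_distrib)
    have "psd_form K (herm3 (of_real D) 0 (of_real B) (of_real D) (of_real E) (of_real D)) \<longleftrightarrow>
      0 \<le> D\<^sup>2 - B\<^sup>2 \<and> 0 \<le> D\<^sup>2 - E\<^sup>2 \<and> (B * E)\<^sup>2 / D\<^sup>2 \<le> (D\<^sup>2 - B\<^sup>2) * (D\<^sup>2 - E\<^sup>2) / D\<^sup>2"
      unfolding psd_form_herm3[OF K of_real_in of_real_in of_real_in[of 0, unfolded of_real_0] that]
        off norm_of_real power2_abs diag sgn
      by (simp add: power2_eq_square[of D])
    also have "\<dots> \<longleftrightarrow> B\<^sup>2 \<le> D\<^sup>2 \<and> E\<^sup>2 \<le> D\<^sup>2 \<and> (B * E)\<^sup>2 \<le> (D\<^sup>2 - B\<^sup>2) * (D\<^sup>2 - E\<^sup>2)"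
      using that by (simp add: divide_le_cancel)
    \<comment> \<open>The terms in \<open>B\<close> and \<open>E\<close> of degree four cancel, and
      a factor of the square of \<open>D\<close> remains.\<close>
    also have "(B * E)\<^sup>2 \<le> (D\<^sup>2 - B\<^sup>2) * (D\<^sup>2 - E\<^sup>2) \<longleftrightarrow> D\<^sup>2 * (B\<^sup>2 + E\<^sup>2) \<le> D\<^sup>2 * D\<^sup>2"
      by (simp add: algebra_simps power_mult_distrib)
    also have "\<dots> \<longleftrightarrow> B\<^sup>2 + E\<^sup>2 \<le> D\<^sup>2"
      using that by (intro mult_le_cancel_left_pos) simp
    finally show ?thesis
      using zero_le_power2[of B] zero_le_power2[of E] by linarith
  qed
  have d: "0 < d" using False assms by simp
  have "f 0 = 0" using f_of_real[of 0] F_0 by simp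
  then show ?thesis
    using two_sided_herm3[OF assms(3,3,3) of_real_in of_real_in of_real_in, of 0 b e]
    by (simp only: f_of_real[OF assms(1)] f_of_real[OF assms(2)] of_real_0 arrow[OF d] arrow[OF F_pos[OF d]])
qed

text \<open>The substitution \<open>t = r^2\<close> turns the equivalence for sums of squares into
  the hypothesis on \<open>q\<close>.\<close>

lemma F_linear: assumes "0 \<le> r" shows "F r = F 1 * r"
proof -
  have "(F (sqrt (r\<^sup>2)))\<^sup>2 = (F (sqrt 1))\<^sup>2 * r\<^sup>2"
    by (rule superadditive_monotone_linear[where q = "\<lambda>t. (F (sqrt t))\<^sup>2"])
      (simp_all add: F_sum_squares F_0)
  then have "(F r)\<^sup>2 = (F 1 * r)\<^sup>2" using assms by (simp add: power_mult_distrib)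
  then show ?thesis using assms F_nonneg[of r] F_nonneg[of 1] by (simp add: power2_eq_iff_nonneg)
qed

lemma cmod_f: assumes "z \<in> K" shows "cmod (f z) = F 1 * cmod z"
proof (rule antisym)
  show "cmod (f z) \<le> F 1 * cmod z"
    using cmod_f_le_iff[of "cmod z" z] F_linear[of "cmod z"] assms by simp
  \<comment> \<open>\<open>F\<close> attains the value \<open>cmod (f z)\<close>, so \<open>cmod_f_le_iff\<close> can be used with equality on its left side\<close>
  show "F 1 * cmod z \<le> cmod (f z)"
  proof -
    have c: "0 < F 1" using F_pos by simp
    have "F (cmod (f z) / F 1) = cmod (f z)" using F_linear[of "cmod (f z) / F 1"] c by simp
    then have "cmod z \<le> cmod (f z) / F 1"
      using cmod_f_le_iff[of "cmod (f z) / F 1" z] c assms by simp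
    then show ?thesis using c by (simp add: field_simps)
  qed
qed

section \<open>The normalised map is an isometry\<close>

definition g :: "complex \<Rightarrow> complex" where "g z = f z / of_real (F 1)"

lemma g_of_real: "0 \<le> r \<Longrightarrow> g (of_real r) = of_real r"
  using f_of_real[of r] F_linear[of r] F_pos[of 1] by (simp add: g_def)

lemma cmod_g: "z \<in> K \<Longrightarrow> cmod (g z) = cmod z"
  using cmod_f[of z] F_pos[of 1] by (simp add: g_def norm_divide)

lemma dist_g_rank_one:
  assumes xyz: "x \<in> K" "y \<in> K" "z \<in> K" and eq: "cmod x = cmod y"
  shows "cmod (g z - g x * cnj (g y)) = cmod (z - x * cnj y)"
proof -
  have c: "0 < F 1" using F_pos by simp
  have fg: "f u = F 1 * g u" for u using c by (simp add: g_def)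
  have "cmod (g z - g x * cnj (g y)) \<le> r \<longleftrightarrow> cmod (z - x * cnj y) \<le> r" if r: "0 \<le> r" for r
  proof -
    \<comment> \<open>Since |x| = |y|, this makes both diagonal entries of the Schur complement
      equal to \<open>r\<close>, so its determinant condition bounds the off-diagonal modulus by
      \<open>r\<close>.\<close>
    define m where "m = r + (cmod x)\<^sup>2"
    have m: "0 \<le> m" using r by (simp add: m_def)
    have "psd_form K (herm3 (of_real m) z x (of_real m) y (of_real 1)) \<longleftrightarrow> (cmod (z - x * cnj y))\<^sup>2 \<le> r * r"
      using psd_form_herm3[OF K xyz, of 1 m m] eq r by (simp add: m_def)
    moreover have "psd_form K (herm3 (F m) (f z) (f x) (F m) (f y) (F 1)) \<longleftrightarrow>
        (F 1)\<^sup>2 * (cmod (g z - g x * cnj (g y)))\<^sup>2 \<le> (F 1)\<^sup>2 * (r * r)"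
    proof -
      have diag: "F m - (cmod (f u))\<^sup>2 / F 1 = F 1 * r" if "u \<in> K" "cmod u = cmod x" for u
        using cmod_f[OF that(1)] F_linear[OF m] c that(2)
        by (simp add: m_def power_mult_distrib power2_eq_square algebra_simps)
      have off: "f z - f x * cnj (f y) / F 1 = F 1 * (g z - g x * cnj (g y))"
        using c by (simp add: fg algebra_simps)
      show ?thesis
        unfolding psd_form_herm3[OF K f_in f_in f_in c, OF xyz] diag[OF xyz(1) refl]
          diag[OF xyz(2) eq[symmetric]] off
        using r c by (simp add: norm_mult power_mult_distrib power2_eq_square mult.assoc mult.left_commute)
    qed
    ultimately have "(cmod (g z - g x * cnj (g y)))\<^sup>2 \<le> r\<^sup>2 \<longleftrightarrow> (cmod (z - x * cnj y))\<^sup>2 \<le> r\<^sup>2"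
      using two_sided_herm3[OF m m zero_le_one xyz] c by (simp add: power2_eq_square)
    then show ?thesis using r by (simp add: abs_le_square_iff[symmetric])
  qed
  \<comment> \<open>Taking each modulus in turn as the bound \<open>r\<close> gives the two
    inequalities.\<close>
  from this[of "cmod (z - x * cnj y)"] this[of "cmod (g z - g x * cnj (g y))"]
  show ?thesis by simp
qed

lemma dist_g:
  assumes z: "z \<in> K" and w: "w \<in> K"
  shows "cmod (g z - g w) = cmod (z - w)"
proof (cases "w = 0")
  case True
  then show ?thesis using cmod_g[OF z] g_of_real[of 0] by simp
next
  case False
  \<comment> \<open>\<open>w\<close> is written as \<open>x * cnj s\<close> with \<open>cmod x = cmod s\<close>\<close>
  define s where "s = sqrt (cmod w)"
  define x where "x = w / of_real s"
  have s: "0 < s" "s * s = cmod w" using False by (auto simp: s_def)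
  have x: "x \<in> K" using w K by (auto simp: x_def)
  have "cmod x = s" using s by (simp add: x_def norm_divide) (metis nonzero_mult_div_cancel_left order_less_irrefl)
  then have *: "cmod (g u - g x * of_real s) = cmod (u - w)" if "u \<in> K" for u
    using dist_g_rank_one[OF x of_real_in that, of s] s by (simp add: g_of_real x_def)
  \<comment> \<open>At \<open>u = w\<close> the distance is zero, which identifies the centre as
    \<open>g w\<close>.\<close>
  from *[OF w] have "g w = g x * of_real s" by simp
  with *[OF z] show ?thesis by simp
qed

text \<open>The distances to the fixed points 0 and 1 determine the real part, and the imaginary
  part up to sign.\<close>

lemma Re_g: assumes "z \<in> K" shows "Re (g z) = Re z" "(Im (g z))\<^sup>2 = (Im z)\<^sup>2"
proof -
  have "(cmod (g z))\<^sup>2 = (cmod z)\<^sup>2" using cmod_g[OF assms] by simp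
  moreover have "(cmod (g z - 1))\<^sup>2 = (cmod (z - 1))\<^sup>2"
    using dist_g[OF assms of_real_in, of 1] g_of_real[of 1] by simp
  ultimately show "Re (g z) = Re z"
    unfolding cmod_power2 by (simp add: power2_diff)
  with \<open>(cmod (g z))\<^sup>2 = (cmod z)\<^sup>2\<close> show "(Im (g z))\<^sup>2 = (Im z)\<^sup>2"
    unfolding cmod_power2 by simp
qed

text \<open>Over the complex numbers the distance to \<open>g \<i>\<close> ties the sign of
  \<open>Im (g z)\<close> to that of \<open>Im (g \<i>)\<close>, so one choice of sign serves all
  \<open>z\<close>.\<close>

lemma g_id_or_cnj: "(\<forall>z\<in>K. g z = z) \<or> (\<forall>z\<in>K. g z = cnj z)"
proof (cases "K = \<real>")
  case True
  then show ?thesis using Re_g by (metis complex_is_Real_iff complex_eqI power2_eq_square zero_eq_power2)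
next
  case False
  then have KU: "K = UNIV" using K by simp
  have gi: "Re (g \<i>) = 0" "Im (g \<i>) = 1 \<or> Im (g \<i>) = -1"
    using Re_g[of \<i>] KU by (auto simp: power2_eq_1_iff)
  have "Im (g z) * Im (g \<i>) = Im z" for z
  proof -
    have "(cmod (g z - g \<i>))\<^sup>2 = (cmod (z - \<i>))\<^sup>2" using dist_g[of z \<i>] KU by simp
    then have "(Im (g z) - Im (g \<i>))\<^sup>2 = (Im z - 1)\<^sup>2"
      unfolding cmod_power2 using Re_g[of z] KU gi by simp
    moreover have "(Im (g z))\<^sup>2 = (Im z)\<^sup>2" "(Im (g \<i>))\<^sup>2 = 1" using Re_g[of z] KU gi by auto
    ultimately show ?thesis by (simp add: power2_diff)
  qed
  note Im = this
  from gi(2) show ?thesis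
  proof
    assume "Im (g \<i>) = 1"
    then have "g z = z" for z using Im[of z] Re_g(1)[of z] KU by (simp add: complex_eq_iff)
    then show ?thesis by blast
  next
    assume "Im (g \<i>) = -1"
    then have "g z = cnj z" for z using Im[of z] Re_g(1)[of z] KU by (simp add: complex_eq_iff)
    then show ?thesis by blast
  qed
qed

lemma multiple_of_id_or_cnj:
  "\<exists>c::real. c > 0 \<and> ((\<forall>z\<in>K. f z = of_real c * z) \<or> (\<forall>z\<in>K. f z = of_real c * cnj z))"
proof -
  have c: "0 < F 1" using F_pos by simp
  then have "f u = F 1 * g u" for u by (simp add: g_def)
  then show ?thesis using g_id_or_cnj c by (intro exI[of _ "F 1"]) auto
qed

end

section \<open>The real and the complex case by contradiction\<close>

theorem corollary1p9:
  fixes n :: nat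
  assumes "n \<ge> 3"
  shows "(\<forall>f :: real \<Rightarrow> real.
            entrywise_positivity_preserver n f \<longrightarrow>
            \<not> pos_multiple_of_id f \<longrightarrow> \<not> pos_multiple_of_conjugate f \<longrightarrow>
            (\<exists>A \<in> carrier_mat n n. \<not> psd_mat n A \<and> psd_mat n (map_mat f A)))
       \<and> (\<forall>f :: complex \<Rightarrow> complex.
            entrywise_positivity_preserver n f \<longrightarrow>
            \<not> pos_multiple_of_id f \<longrightarrow> \<not> pos_multiple_of_conjugate f \<longrightarrow>
            (\<exists>A \<in> carrier_mat n n. \<not> psd_mat n A \<and> psd_mat n (map_mat f A)))"
proof (intro conjI allI impI; rule ccontr)
  fix f :: "real \<Rightarrow> real"
  assume f: "entrywise_positivity_preserver n f" "\<not> pos_multiple_of_id f"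
    and no: "\<not> (\<exists>A \<in> carrier_mat n n. \<not> psd_mat n A \<and> psd_mat n (map_mat f A))"
  \<comment> \<open>One direction is preservation, the other is the assumed absence of a matrix
    \<open>A\<close>.\<close>
  have two: "psd_form \<real> (\<lambda>p q. complex_of_real (f (b p q))) \<longleftrightarrow> psd_form \<real> (\<lambda>p q. complex_of_real (b p q))" for b
    using f(1) no unfolding psd_blow_up_real[OF assms, symmetric] map_mat_blow_up[symmetric]
      entrywise_positivity_preserver_def using blow_up_carrier by blast
  \<comment> \<open>Precomposing with \<open>Re\<close> extends \<open>f\<close> to the complex
    numbers; on the reals it agrees with \<open>f\<close>.\<close>
  interpret two_sided_preserver \<real> "\<lambda>z. of_real (f (Re z))"
  proof
    fix a :: "nat \<Rightarrow> nat \<Rightarrow> complex" assume "\<And>p q. a p q \<in> \<real>"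
    then show "psd_form \<real> (\<lambda>p q. of_real (f (Re (a p q)))) \<longleftrightarrow> psd_form \<real> a"
      using two[of "\<lambda>p q. Re (a p q)"] by simp
  qed auto
  obtain c :: real where c: "c > 0"
    and "(\<forall>z\<in>\<real>. of_real (f (Re z)) = of_real c * z) \<or> (\<forall>z\<in>\<real>. of_real (f (Re z)) = of_real c * cnj z)"
    using multiple_of_id_or_cnj by blast
  then have "complex_of_real (f x) = of_real (c * x)" for x by (metis Re_complex_of_real Reals_of_real complex_cnj_complex_of_real of_real_mult)
  then have "f x = c * x" for x by (simp only: of_real_eq_iff)
  with c f(2) show False by (auto simp: pos_multiple_of_id_def)
next
  fix f :: "complex \<Rightarrow> complex"
  assume f: "entrywise_positivity_preserver n f" "\<not> pos_multiple_of_id f" "\<not> pos_multiple_of_conjugate f"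
    and no: "\<not> (\<exists>A \<in> carrier_mat n n. \<not> psd_mat n A \<and> psd_mat n (map_mat f A))"
  interpret two_sided_preserver UNIV f
  proof
    fix a :: "nat \<Rightarrow> nat \<Rightarrow> complex"
    show "psd_form UNIV (\<lambda>p q. f (a p q)) \<longleftrightarrow> psd_form UNIV a"
      using f(1) no unfolding psd_blow_up_complex[OF assms, symmetric] map_mat_blow_up[symmetric]
        entrywise_positivity_preserver_def using blow_up_carrier by blast
  qed auto
  show False
    using multiple_of_id_or_cnj f(2,3) by (auto simp: pos_multiple_of_id_def pos_multiple_of_conjugate_def)
qed

end
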